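(* Let $\mathcal{C}$ be a finite connected category. There exist only finitely many isomorphism classes of simple $\mathcal{C}$-sets.
   Context: For a finite category $\mathcal{C}$, a $\mathcal{C}$-set is a covariant functor from $\mathcal{C}$ to the category of finite sets; morphisms of $\mathcal{C}$-sets are natural transformations; a $\mathcal{C}$-subset is a subfunctor. A $\mathcal{C}$-set is simple if it is non-empty (takes a non-empty value at some object) and its only $\mathcal{C}$-subsets are itself and the empty $\mathcal{C}$-set (sending every object to $\emptyset$). *)

theory Defs
  imports Main "HOL-Library.FuncSet"
begin

section \<open>Categories\<close>

text \<open>
  The objects and arrows form explicit carrier sets, so only values on these carriers matter;
  \<open>Comp C g f\<close> is \<open>g\<close> after \<open>f\<close> and matters only when \<open>Cod C f = Dom C g\<close>.
\<close>

record ('o, 'm) category =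
  Obj :: "'o set"
  Arr :: "'m set"
  Dom :: "'m \<Rightarrow> 'o"
  Cod :: "'m \<Rightarrow> 'o"
  Id :: "'o \<Rightarrow> 'm"
  Comp :: "'m \<Rightarrow> 'm \<Rightarrow> 'm"

locale category =
  fixes C :: "('o, 'm) category"
  assumes Dom_Obj: "f \<in> Arr C \<Longrightarrow> Dom C f \<in> Obj C"
    and Cod_Obj: "f \<in> Arr C \<Longrightarrow> Cod C f \<in> Obj C"
    and Id_Arr: "a \<in> Obj C \<Longrightarrow> Id C a \<in> Arr C"
    and Dom_Id: "a \<in> Obj C \<Longrightarrow> Dom C (Id C a) = a"
    and Cod_Id: "a \<in> Obj C \<Longrightarrow> Cod C (Id C a) = a"
    and Comp_Arr: "\<lbrakk>f \<in> Arr C; g \<in> Arr C; Cod C f = Dom C g\<rbrakk> \<Longrightarrow> Comp C g f \<in> Arr C"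
    and Dom_Comp: "\<lbrakk>f \<in> Arr C; g \<in> Arr C; Cod C f = Dom C g\<rbrakk> \<Longrightarrow> Dom C (Comp C g f) = Dom C f"
    and Cod_Comp: "\<lbrakk>f \<in> Arr C; g \<in> Arr C; Cod C f = Dom C g\<rbrakk> \<Longrightarrow> Cod C (Comp C g f) = Cod C g"
    and Comp_Id_right: "f \<in> Arr C \<Longrightarrow> Comp C f (Id C (Dom C f)) = f"
    and Comp_Id_left: "f \<in> Arr C \<Longrightarrow> Comp C (Id C (Cod C f)) f = f"
    and Comp_assoc: "\<lbrakk>f \<in> Arr C; g \<in> Arr C; h \<in> Arr C; Cod C f = Dom C g; Cod C g = Dom C h\<rbrakk>
      \<Longrightarrow> Comp C h (Comp C g f) = Comp C (Comp C h g) f"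

locale finite_category = category +
  assumes finite_Obj: "finite (Obj C)"
    and finite_Arr: "finite (Arr C)"

definition arrow_rel :: "('o, 'm) category \<Rightarrow> ('o \<times> 'o) set" where
  "arrow_rel C = {(Dom C f, Cod C f) | f. f \<in> Arr C}"

text \<open>
  A connected category is non-empty, and any two of its objects are joined by a finite zigzag
  of arrows.
\<close>

locale connected_category = category +
  assumes Obj_nonempty: "Obj C \<noteq> {}"
    and zigzag: "\<lbrakk>a \<in> Obj C; b \<in> Obj C\<rbrakk> \<Longrightarrow> (a, b) \<in> (arrow_rel C \<union> (arrow_rel C)\<inverse>)\<^sup>*"

section \<open>C-sets\<close>

text \<open>
  The elements of the sets \<open>Fobj F a\<close> are drawn from an arbitrary type \<open>'x\<close>. Functions
  between such sets are compared on their domains only, so values of \<open>Fobj F\<close> and \<open>Fmap F\<close>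
  outside the relevant carriers are irrelevant.
\<close>

record ('o, 'm, 'x) cset =
  Fobj :: "'o \<Rightarrow> 'x set"
  Fmap :: "'m \<Rightarrow> 'x \<Rightarrow> 'x"

locale cset = category C for C :: "('o, 'm) category" +
  fixes F :: "('o, 'm, 'x) cset"
  assumes finite_Fobj: "a \<in> Obj C \<Longrightarrow> finite (Fobj F a)"
    and Fmap_funcset: "f \<in> Arr C \<Longrightarrow> Fmap F f \<in> Fobj F (Dom C f) \<rightarrow> Fobj F (Cod C f)"
    and Fmap_Id: "\<lbrakk>a \<in> Obj C; x \<in> Fobj F a\<rbrakk> \<Longrightarrow> Fmap F (Id C a) x = x"
    and Fmap_Comp: "\<lbrakk>f \<in> Arr C; g \<in> Arr C; Cod C f = Dom C g; x \<in> Fobj F (Dom C f)\<rbrakk>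
      \<Longrightarrow> Fmap F (Comp C g f) x = Fmap F g (Fmap F f x)"

locale natural_transformation = dom: cset C F + cod: cset C G
  for C :: "('o, 'm) category"
    and F :: "('o, 'm, 'x) cset"
    and G :: "('o, 'm, 'y) cset" +
  fixes \<eta> :: "'o \<Rightarrow> 'x \<Rightarrow> 'y"
  assumes component: "a \<in> Obj C \<Longrightarrow> \<eta> a \<in> Fobj F a \<rightarrow> Fobj G a"
    and naturality: "\<lbrakk>f \<in> Arr C; x \<in> Fobj F (Dom C f)\<rbrakk>
      \<Longrightarrow> \<eta> (Cod C f) (Fmap F f x) = Fmap G f (\<eta> (Dom C f) x)"

definition cset_isomorphic ::
  "('o, 'm) category \<Rightarrow> ('o, 'm, 'x) cset \<Rightarrow> ('o, 'm, 'y) cset \<Rightarrow> bool" where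
  "cset_isomorphic C F G \<longleftrightarrow>
    (\<exists>\<eta> \<theta>. natural_transformation C F G \<eta> \<and> natural_transformation C G F \<theta> \<and>
      (\<forall>a\<in>Obj C. (\<forall>x\<in>Fobj F a. \<theta> a (\<eta> a x) = x) \<and> (\<forall>y\<in>Fobj G a. \<eta> a (\<theta> a y) = y)))"

definition csubset ::
  "('o, 'm) category \<Rightarrow> ('o, 'm, 'x) cset \<Rightarrow> ('o, 'm, 'x) cset \<Rightarrow> bool" where
  "csubset C G F \<longleftrightarrow> cset C G \<and> cset C F \<and>
    (\<forall>a\<in>Obj C. Fobj G a \<subseteq> Fobj F a) \<and>
    (\<forall>f\<in>Arr C. \<forall>x\<in>Fobj G (Dom C f). Fmap G f x = Fmap F f x)"

definition empty_cset :: "('o, 'm) category \<Rightarrow> ('o, 'm, 'x) cset \<Rightarrow> bool" where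
  "empty_cset C F \<longleftrightarrow> (\<forall>a\<in>Obj C. Fobj F a = {})"

text \<open>
  A \<open>C\<close>-subset of \<open>F\<close> with the same sets as \<open>F\<close> also has the same maps, so comparing the sets
  suffices to say that it is \<open>F\<close> itself.
\<close>

definition simple_cset :: "('o, 'm) category \<Rightarrow> ('o, 'm, 'x) cset \<Rightarrow> bool" where
  "simple_cset C F \<longleftrightarrow> cset C F \<and> \<not> empty_cset C F \<and>
    (\<forall>G. csubset C G F \<longrightarrow> (\<forall>a\<in>Obj C. Fobj G a = Fobj F a) \<or> empty_cset C G)"

definition cset_iso_rel ::
  "('o, 'm) category \<Rightarrow> (('o, 'm, 'x) cset \<times> ('o, 'm, 'x) cset) set" where
  "cset_iso_rel C = {(F, G). cset_isomorphic C F G}"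

text \<open>
  Since every finite set is in bijection with a set of natural numbers, taking \<open>'x\<close> to be
  \<open>nat\<close> already yields all isomorphism classes.
\<close>

definition simple_cset_classes ::
  "'x itself \<Rightarrow> ('o, 'm) category \<Rightarrow> ('o, 'm, 'x) cset set set" where
  "simple_cset_classes _ C = {F. simple_cset C F} // cset_iso_rel C"

end

(* A simple C-set F is generated by any single element x of any F(a), since the images of x under
   the arrows out of a form a non-empty C-subset. A C-set generated by x in F(a) is determined up to
   isomorphism by a and by the set of parallel pairs of arrows out of a which agree on x; for a
   finite category there are only finitely many such data. *)
theory Submission
  imports Defs
begin

text \<open>By the Yoneda lemma, an element \<open>x\<close> of \<open>Fobj F a\<close> amounts to a
  natural map to \<open>F\<close> from the representable functor \<open>Hom(a, -)\<close>. The last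
  conjunct makes this map surjective.\<close>

definition generates :: "('o, 'm) category \<Rightarrow> ('o, 'm, 'x) cset \<Rightarrow> 'o \<Rightarrow> 'x \<Rightarrow> bool" where
  "generates C F a x \<longleftrightarrow> a \<in> Obj C \<and> x \<in> Fobj F a \<and>
    (\<forall>b\<in>Obj C. \<forall>z\<in>Fobj F b. \<exists>f\<in>Arr C. Dom C f = a \<and> Cod C f = b \<and> Fmap F f x = z)"

text \<open>The kernel pair of the Yoneda map \<open>f\<close> to \<open>Fmap F f x\<close> on
  arrows out of \<open>a\<close>. When \<open>x\<close> generates \<open>F\<close>, it presents
  \<open>F\<close> as a quotient of the representable functor at \<open>a\<close>.\<close>

definition relations :: "('o, 'm) category \<Rightarrow> ('o, 'm, 'x) cset \<Rightarrow> 'o \<Rightarrow> 'x \<Rightarrow> ('m \<times> 'm) set" where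
  "relations C F a x = {(f, g). f \<in> Arr C \<and> g \<in> Arr C \<and> Dom C f = a \<and> Dom C g = a \<and>
    Cod C f = Cod C g \<and> Fmap F f x = Fmap F g x}"

lemma relationsI:
  assumes "f \<in> Arr C" "g \<in> Arr C" "Dom C f = a" "Dom C g = a" "Cod C f = Cod C g"
    and "Fmap F f x = Fmap F g x"
  shows "(f, g) \<in> relations C F a x"
  using assms by (simp add: relations_def)

lemma (in cset) Fmap_in:
  "\<lbrakk>f \<in> Arr C; x \<in> Fobj F (Dom C f)\<rbrakk> \<Longrightarrow> Fmap F f x \<in> Fobj F (Cod C f)"
  using Fmap_funcset by blast

lemma simple_cset_generates:
  assumes simple: "simple_cset C F" and a: "a \<in> Obj C" and x: "x \<in> Fobj F a"
  shows "generates C F a x"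
proof -
  interpret cset C F
    using simple by (simp add: simple_cset_def)
  \<comment> \<open>The orbit of \<open>x\<close>. Only the sets change; the maps of
    \<open>F\<close> are kept, so the identity and composition laws are inherited by
    restriction.\<close>
  define G where "G = F\<lparr>Fobj := \<lambda>b. {Fmap F f x | f. f \<in> Arr C \<and> Dom C f = a \<and> Cod C f = b}\<rparr>"
  have G_Fobj: "Fobj G b = {Fmap F f x | f. f \<in> Arr C \<and> Dom C f = a \<and> Cod C f = b}"
    and G_Fmap: "Fmap G = Fmap F" for b
    by (simp_all add: G_def)
  have sub: "Fobj G b \<subseteq> Fobj F b" for b
    using x Fmap_in by (auto simp: G_Fobj)
  have "cset C G"
  proof unfold_locales
    fix b assume "b \<in> Obj C"
    then show "finite (Fobj G b)"
      using sub finite_Fobj finite_subset by blast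
    show "Fmap G (Id C b) z = z" if "z \<in> Fobj G b" for z
      using that sub \<open>b \<in> Obj C\<close> Fmap_Id by (auto simp: G_Fmap)
  next
    fix f assume f: "f \<in> Arr C"
    show "Fmap G f \<in> Fobj G (Dom C f) \<rightarrow> Fobj G (Cod C f)"
    proof
      fix z assume "z \<in> Fobj G (Dom C f)"
      then obtain h where h: "h \<in> Arr C" "Dom C h = a" "Cod C h = Dom C f" "z = Fmap F h x"
        by (auto simp: G_Fobj)
      \<comment> \<open>An element reached from \<open>x\<close> by \<open>h\<close> is carried by
        \<open>f\<close> to the element reached by the composite, so the orbit is closed under all
        arrows.\<close>
      then have "Fmap F f z = Fmap F (Comp C f h) x"
        using f x Fmap_Comp by simp
      then show "Fmap G f z \<in> Fobj G (Cod C f)"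
        using h f Comp_Arr Dom_Comp Cod_Comp by (auto simp: G_Fobj G_Fmap)
    qed
  next
    fix f g z
    assume "f \<in> Arr C" "g \<in> Arr C" "Cod C f = Dom C g" "z \<in> Fobj G (Dom C f)"
    then show "Fmap G (Comp C g f) z = Fmap G g (Fmap G f z)"
      using sub Fmap_Comp by (simp add: G_Fmap subset_eq)
  qed
  then have "csubset C G F"
    using sub cset_axioms by (auto simp: csubset_def G_Fmap)
  \<comment> \<open>The identity arrow at \<open>a\<close> puts an element into the orbit
    there.\<close>
  moreover have "\<not> empty_cset C G"
    unfolding empty_cset_def G_Fobj using a Id_Arr Dom_Id Cod_Id by blast
  ultimately have eq: "Fobj G b = Fobj F b" if "b \<in> Obj C" for b
    using simple that by (auto simp: simple_cset_def)
  have "\<exists>f\<in>Arr C. Dom C f = a \<and> Cod C f = b \<and> Fmap F f x = z"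
    if "b \<in> Obj C" "z \<in> Fobj F b" for b z
    using that(2) unfolding eq[OF that(1), symmetric] G_Fobj by blast
  then show ?thesis
    using a x by (simp add: generates_def)
qed

text \<open>A natural map taking \<open>x\<close> to \<open>y\<close> is forced to take
  \<open>Fmap F f x\<close> to \<open>Fmap G f y\<close>. Generation by \<open>x\<close> defines
  this everywhere, and the inclusion of relations makes it well defined.\<close>

lemma generates_natural_transformation:
  assumes "cset C F" and "cset C G"
    and gen: "generates C F a x" and y: "y \<in> Fobj G a"
    and rel: "relations C F a x \<subseteq> relations C G a y"
  obtains \<eta> where "natural_transformation C F G \<eta>"
    and "\<And>f. \<lbrakk>f \<in> Arr C; Dom C f = a\<rbrakk> \<Longrightarrow> \<eta> (Cod C f) (Fmap F f x) = Fmap G f y"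
proof -
  interpret F: cset C F by fact
  interpret G: cset C G by fact
  \<comment> \<open>An arbitrary arrow carrying \<open>x\<close> to \<open>z\<close> is chosen; the
    fact \<open>eta\<close> below shows that the result does not depend on the choice.\<close>
  define \<eta> where
    "\<eta> b z = Fmap G (SOME f. f \<in> Arr C \<and> Dom C f = a \<and> Cod C f = b \<and> Fmap F f x = z) y" for b z
  have eta: "\<eta> (Cod C f) (Fmap F f x) = Fmap G f y" if f: "f \<in> Arr C" "Dom C f = a" for f
  proof -
    define g where
      "g = (SOME g. g \<in> Arr C \<and> Dom C g = a \<and> Cod C g = Cod C f \<and> Fmap F g x = Fmap F f x)"
    have "g \<in> Arr C \<and> Dom C g = a \<and> Cod C g = Cod C f \<and> Fmap F g x = Fmap F f x"
      unfolding g_def by (rule someI[where x = f]) (simp add: f)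
    \<comment> \<open>The chosen \<open>g\<close> and the given \<open>f\<close> agree on
      \<open>x\<close>, so by \<open>rel\<close> they also agree on \<open>y\<close>.\<close>
    then have "(g, f) \<in> relations C G a y"
      using f rel by (blast intro: relationsI)
    then show ?thesis
      by (simp add: relations_def \<eta>_def g_def)
  qed
  have x: "x \<in> Fobj F a"
    using gen by (simp add: generates_def)
  have gen': "\<exists>f\<in>Arr C. Dom C f = a \<and> Cod C f = b \<and> Fmap F f x = z"
    if "b \<in> Obj C" "z \<in> Fobj F b" for b z
    using gen that by (auto simp: generates_def)
  have "natural_transformation C F G \<eta>"
  proof unfold_locales
    show "\<eta> b \<in> Fobj F b \<rightarrow> Fobj G b" if "b \<in> Obj C" for b
    proof
      fix z assume "z \<in> Fobj F b"
      with gen' \<open>b \<in> Obj C\<close> obtain f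
        where "f \<in> Arr C" "Dom C f = a" "Cod C f = b" "Fmap F f x = z"
        by blast
      then show "\<eta> b z \<in> Fobj G b"
        using eta y G.Fmap_in by metis
    qed
    show "\<eta> (Cod C f) (Fmap F f z) = Fmap G f (\<eta> (Dom C f) z)"
      if f: "f \<in> Arr C" and z: "z \<in> Fobj F (Dom C f)" for f z
    proof -
      \<comment> \<open>Writing \<open>z\<close> as the image of \<open>x\<close> under
        \<open>h\<close> reduces naturality to functoriality of \<open>F\<close> and
        \<open>G\<close> at the composite of \<open>f\<close> and \<open>h\<close>.\<close>
      obtain h where h: "h \<in> Arr C" "Dom C h = a" "Cod C h = Dom C f" "z = Fmap F h x"
        using gen' F.Dom_Obj f z by metis
      have "\<eta> (Cod C f) (Fmap F f z) = \<eta> (Cod C (Comp C f h)) (Fmap F (Comp C f h) x)"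
        using f h x by (simp add: F.Fmap_Comp F.Cod_Comp)
      also have "\<dots> = Fmap G (Comp C f h) y"
        using f h by (intro eta) (simp_all add: F.Comp_Arr F.Dom_Comp)
      also have "\<dots> = Fmap G f (Fmap G h y)"
        using f h y by (simp add: G.Fmap_Comp)
      also have "Fmap G h y = \<eta> (Dom C f) z"
        using h eta by metis
      finally show ?thesis .
    qed
  qed
  then show thesis
    using that eta by blast
qed

text \<open>Each inclusion of relations yields a natural map in one direction. The two maps exchange
  \<open>Fmap F f x\<close> and \<open>Fmap G f y\<close>, and these exhaust both C-sets, so they
  are mutually inverse.\<close>

lemma generates_isomorphic:
  assumes F: "cset C F" "generates C F a x" and G: "cset C G" "generates C G a y"
    and rel: "relations C F a x = relations C G a y"
  shows "cset_isomorphic C F G"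
proof -
  have x: "x \<in> Fobj F a" and y: "y \<in> Fobj G a"
    using F G by (simp_all add: generates_def)
  obtain \<eta> where \<eta>: "natural_transformation C F G \<eta>"
    "\<And>f. \<lbrakk>f \<in> Arr C; Dom C f = a\<rbrakk> \<Longrightarrow> \<eta> (Cod C f) (Fmap F f x) = Fmap G f y"
    using generates_natural_transformation[OF F(1) G(1) F(2) y] rel by blast
  obtain \<theta> where \<theta>: "natural_transformation C G F \<theta>"
    "\<And>f. \<lbrakk>f \<in> Arr C; Dom C f = a\<rbrakk> \<Longrightarrow> \<theta> (Cod C f) (Fmap G f y) = Fmap F f x"
    using generates_natural_transformation[OF G(1) F(1) G(2) x] rel by blast
  have "\<theta> b (\<eta> b z) = z" if "b \<in> Obj C" "z \<in> Fobj F b" for b z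
    using F(2) that \<eta>(2) \<theta>(2) unfolding generates_def by metis
  moreover have "\<eta> b (\<theta> b z) = z" if "b \<in> Obj C" "z \<in> Fobj G b" for b z
    using G(2) that \<eta>(2) \<theta>(2) unfolding generates_def by metis
  ultimately show ?thesis
    using \<eta>(1) \<theta>(1) unfolding cset_isomorphic_def by blast
qed

lemma natural_transformation_comp:
  assumes "natural_transformation C F G \<eta>" and "natural_transformation C G H \<theta>"
  shows "natural_transformation C F H (\<lambda>a. \<theta> a \<circ> \<eta> a)"
proof -
  interpret \<eta>: natural_transformation C F G \<eta> by fact
  interpret \<theta>: natural_transformation C G H \<theta> by fact
  show ?thesis
  proof unfold_locales
    show "\<theta> a \<circ> \<eta> a \<in> Fobj F a \<rightarrow> Fobj H a" if "a \<in> Obj C" for a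
      using \<eta>.component[OF that] \<theta>.component[OF that] by auto
    show "(\<theta> (Cod C f) \<circ> \<eta> (Cod C f)) (Fmap F f x) = Fmap H f ((\<theta> (Dom C f) \<circ> \<eta> (Dom C f)) x)"
      if f: "f \<in> Arr C" and x: "x \<in> Fobj F (Dom C f)" for f x
    proof -
      have "\<eta> (Dom C f) x \<in> Fobj G (Dom C f)"
        using \<eta>.component[OF \<eta>.dom.Dom_Obj[OF f]] x by blast
      then show ?thesis
        using f x by (simp add: \<eta>.naturality \<theta>.naturality)
    qed
  qed
qed

lemma cset_isomorphic_sym: "cset_isomorphic C F G \<Longrightarrow> cset_isomorphic C G F"
  unfolding cset_isomorphic_def by blast

lemma cset_isomorphic_trans:
  assumes "cset_isomorphic C F G" and "cset_isomorphic C G H"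
  shows "cset_isomorphic C F H"
proof -
  obtain \<eta> \<theta> where 1: "natural_transformation C F G \<eta>" "natural_transformation C G F \<theta>"
    and inv1: "\<And>a x. \<lbrakk>a \<in> Obj C; x \<in> Fobj F a\<rbrakk> \<Longrightarrow> \<theta> a (\<eta> a x) = x"
      "\<And>a y. \<lbrakk>a \<in> Obj C; y \<in> Fobj G a\<rbrakk> \<Longrightarrow> \<eta> a (\<theta> a y) = y"
    using assms(1) unfolding cset_isomorphic_def by blast
  obtain \<eta>' \<theta>' where 2: "natural_transformation C G H \<eta>'" "natural_transformation C H G \<theta>'"
    and inv2: "\<And>a x. \<lbrakk>a \<in> Obj C; x \<in> Fobj G a\<rbrakk> \<Longrightarrow> \<theta>' a (\<eta>' a x) = x"
      "\<And>a y. \<lbrakk>a \<in> Obj C; y \<in> Fobj H a\<rbrakk> \<Longrightarrow> \<eta>' a (\<theta>' a y) = y"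
    using assms(2) unfolding cset_isomorphic_def by blast
  have "\<eta> a x \<in> Fobj G a" if "a \<in> Obj C" "x \<in> Fobj F a" for a x
    using natural_transformation.component[OF 1(1)] that by blast
  moreover have "\<theta>' a y \<in> Fobj G a" if "a \<in> Obj C" "y \<in> Fobj H a" for a y
    using natural_transformation.component[OF 2(2)] that by blast
  ultimately show ?thesis
    using natural_transformation_comp[OF 1(1) 2(1)] natural_transformation_comp[OF 2(2) 1(2)]
    unfolding cset_isomorphic_def
    by (intro exI[of _ "\<lambda>a. \<eta>' a \<circ> \<eta> a"] exI[of _ "\<lambda>a. \<theta> a \<circ> \<theta>' a"]) (simp add: inv1 inv2)
qed

text \<open>Elements of the quotient are images of singletons under \<open>cset_iso_rel\<close>;
  this allows a representative to be exchanged for an isomorphic one.\<close>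

lemma cset_iso_rel_Image_eq:
  "cset_isomorphic C F G \<Longrightarrow> cset_iso_rel C `` {F} = cset_iso_rel C `` {G}"
  by (auto simp: cset_iso_rel_def intro: cset_isomorphic_sym cset_isomorphic_trans)

theorem corollary3p15:
  fixes C :: "('o, 'm) category"
  assumes "finite_category C"
    and "connected_category C"
  shows "finite (simple_cset_classes TYPE('x) C)"
proof -
  interpret finite_category C by fact
  \<comment> \<open>All C-sets, simple or not, presented by a generator at \<open>a\<close> with
    relations \<open>R\<close>. Any two of them are isomorphic.\<close>
  define K :: "'o \<times> ('m \<times> 'm) set \<Rightarrow> ('o, 'm, 'x) cset set" where
    "K = (\<lambda>(a, R). {F. cset C F \<and> (\<exists>x. generates C F a x \<and> relations C F a x = R)})"
  \<comment> \<open>Taking the image of the whole of \<open>K v\<close> avoids choosing a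
    representative. Data realized by no C-set only add the empty set on the right.\<close>
  have "simple_cset_classes TYPE('x) C
    \<subseteq> (\<lambda>v. cset_iso_rel C `` K v) ` (Obj C \<times> Pow (Arr C \<times> Arr C))"
  proof
    fix S :: "('o, 'm, 'x) cset set"
    assume "S \<in> simple_cset_classes TYPE('x) C"
    then obtain F where F: "simple_cset C F" and S: "S = cset_iso_rel C `` {F}"
      by (auto simp: simple_cset_classes_def elim: quotientE)
    then obtain a x where a: "a \<in> Obj C" and x: "x \<in> Fobj F a"
      by (auto simp: simple_cset_def empty_cset_def)
    let ?v = "(a, relations C F a x)"
    have "cset C F"
      using F by (simp add: simple_cset_def)
    moreover have "generates C F a x"
      using F a x by (rule simple_cset_generates)
    ultimately have "F \<in> K ?v" and "\<And>G. G \<in> K ?v \<Longrightarrow> cset_isomorphic C F G"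
      by (auto simp: K_def intro: generates_isomorphic)
    \<comment> \<open>\<open>F\<close> lies in \<open>K ?v\<close> and every member is isomorphic to
      \<open>F\<close>, so the union of the members' classes is the class of
      \<open>F\<close>.\<close>
    then have "S = cset_iso_rel C `` K ?v"
      unfolding S using cset_iso_rel_Image_eq by blast
    moreover have "?v \<in> Obj C \<times> Pow (Arr C \<times> Arr C)"
      using a by (auto simp: relations_def)
    ultimately show "S \<in> (\<lambda>v. cset_iso_rel C `` K v) ` (Obj C \<times> Pow (Arr C \<times> Arr C))"
      by blast
  qed
  then show ?thesis
    by (rule finite_subset) (simp add: finite_Obj finite_Arr)
qed

end
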